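(* Let $m\ge 2$ be an integer, and let $f_m : (\mathbb{Z}/m^{2}\mathbb{Z},+) \to (\mathbb{Z}/m\mathbb{Z},+)$ be the function defined by $f_m(x)=C_m(x)\bmod m$ if $\gcd(x,m)=1$ and $f_m(x)=0$ if $\gcd(x,m)\neq 1$. Then $f_m$ is perfect nonlinear if and only if $m$ is a prime number.
   Context: $\lambda$ denotes the Carmichael function: $\lambda(m)$ is the exponent of $(\mathbb{Z}/m\mathbb{Z})^{*}$. For coprime integers $m\ge 2$ and $a$, the Carmichael quotient is the integer $C_{m}(a)=\frac{a^{\lambda(m)}-1}{m}$; its residue modulo $m$ depends only on $a$ modulo $m^2$, so $f_m$ is well defined. Let $(A,+)$ and $(B,+)$ be finite abelian groups with $|A|$ a multiple of $|B|$. A function $f: A\to B$ is called perfect nonlinear if for every non-identity element $a\in A$ and every $b\in B$, $|\{x\in A: f(x+a)-f(x)=b\}|=\frac{|A|}{|B|}$. *)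

theory Defs
  imports "HOL-Algebra.Elementary_Groups" "HOL-Number_Theory.Residue_Primitive_Roots"
begin

text \<open>
  The groups are abelian but, following HOL-Algebra, they are written multiplicatively:
  \<open>f (x \<otimes>\<^bsub>A\<^esub> a) \<otimes>\<^bsub>B\<^esub> inv\<^bsub>B\<^esub> f x\<close> is $f(x+a)-f(x)$.  The side conditions on
  \<open>A\<close>, \<open>B\<close> and \<open>f\<close> are part of the definition; the lemma
  \<open>carmichael_fun_setting\<close> below shows that they always hold in our application.
\<close>

definition perfect_nonlinear ::
  "('a, 'c) monoid_scheme \<Rightarrow> ('b, 'd) monoid_scheme \<Rightarrow> ('a \<Rightarrow> 'b) \<Rightarrow> bool" where
  "perfect_nonlinear A B f \<longleftrightarrow>
     comm_group A \<and> finite (carrier A) \<and> comm_group B \<and> finite (carrier B) \<and>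
     order B dvd order A \<and> f \<in> carrier A \<rightarrow> carrier B \<and>
     (\<forall>a \<in> carrier A - {\<one>\<^bsub>A\<^esub>}. \<forall>b \<in> carrier B.
        card {x \<in> carrier A. f (x \<otimes>\<^bsub>A\<^esub> a) \<otimes>\<^bsub>B\<^esub> inv\<^bsub>B\<^esub> (f x) = b} = order A div order B)"

text \<open>
  The division is exact when \<open>a\<close> is coprime to \<open>m\<close>, see \<open>carmichael_quotient_exact\<close>.
\<close>

definition carmichael_quotient :: "nat \<Rightarrow> int \<Rightarrow> int" where
  "carmichael_quotient m a = (a ^ Carmichael m - 1) div int m"

text \<open>
  Elements of $\mathbb{Z}/n\mathbb{Z}$ are represented as in \<open>integer_mod_group n\<close>, i.e. by the
  integers in \<open>{0..<n}\<close>.  By \<open>carmichael_fun_cong\<close> the value of the following function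
  depends only on the class of its argument modulo \<open>m\<^sup>2\<close>.
\<close>

definition carmichael_fun :: "nat \<Rightarrow> int \<Rightarrow> int" where
  "carmichael_fun m x =
     (if gcd x (int m) = 1 then carmichael_quotient m x mod int m else 0)"

lemma carmichael_quotient_exact:
  assumes "m \<ge> 2" and "coprime a (int m)"
  shows "int m * carmichael_quotient m a = a ^ Carmichael m - 1"
proof -
  define k where "k = nat (a mod int m)"
  have k: "int k = a mod int m"
    using assms(1) by (simp add: k_def)
  have "coprime (int m) (int k)"
    using assms by (simp add: k coprime_commute)
  then have "[k ^ Carmichael m = 1] (mod m)"
    by (intro Carmichael_divides) auto
  then have "[int k ^ Carmichael m = 1] (mod int m)"
    by (metis cong_int_iff of_nat_1 of_nat_power)
  then have "[a ^ Carmichael m = 1] (mod int m)"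
    by (simp add: k cong_def power_mod)
  then have "int m dvd a ^ Carmichael m - 1"
    by (simp add: cong_iff_dvd_diff)
  then show ?thesis
    by (simp add: carmichael_quotient_def)
qed

lemma carmichael_fun_cong:
  assumes "m \<ge> 2" and "[x = y] (mod int (m\<^sup>2))"
  shows "carmichael_fun m x = carmichael_fun m y"
proof -
  have "[x = y] (mod int m)"
    using assms(2) by (rule cong_dvd_modulus) (simp add: power2_eq_square)
  then have gcd: "gcd x (int m) = gcd y (int m)"
    using cong_gcd_eq by blast
  show ?thesis
  proof (cases "gcd x (int m) = 1")
    case True
    then have "coprime x (int m)" "coprime y (int m)"
      using gcd by (simp_all add: coprime_iff_gcd_eq_1)
    then have "int m * carmichael_quotient m x - int m * carmichael_quotient m y
        = x ^ Carmichael m - y ^ Carmichael m"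
      using assms(1) by (simp add: carmichael_quotient_exact)
    moreover have "int m * int m dvd x ^ Carmichael m - y ^ Carmichael m"
      using cong_pow[OF assms(2), of "Carmichael m"]
      by (simp add: cong_iff_dvd_diff power2_eq_square)
    ultimately have "int m * int m dvd int m * (carmichael_quotient m x - carmichael_quotient m y)"
      by (simp add: right_diff_distrib)
    then have "int m dvd carmichael_quotient m x - carmichael_quotient m y"
      using assms(1) by simp
    then show ?thesis
      using True gcd by (simp add: carmichael_fun_def mod_eq_dvd_iff)
  next
    case False
    then show ?thesis
      using gcd by (simp add: carmichael_fun_def)
  qed
qed

lemma carmichael_fun_setting:
  assumes "m \<ge> 2"
  shows "comm_group (integer_mod_group (m\<^sup>2))" "finite (carrier (integer_mod_group (m\<^sup>2)))"
    "comm_group (integer_mod_group m)" "finite (carrier (integer_mod_group m))"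
    "order (integer_mod_group m) dvd order (integer_mod_group (m\<^sup>2))"
    "carmichael_fun m \<in> carrier (integer_mod_group (m\<^sup>2)) \<rightarrow> carrier (integer_mod_group m)"
  using assms
  by (auto simp: carrier_integer_mod_group order_def carmichael_fun_def power2_eq_square
      nat_mult_distrib)

end

theory Submission
  imports Defs
begin

text \<open>
  For a prime $p$ one has $x\,(f(x+pk)-f(x)) \equiv -k \pmod p$ whenever $p \nmid x$, because
  $x \cdot p\,C_p(x) = x^p - x$ and $x^p$ modulo $p^2$ depends only on $x$ modulo $p$.
  Hence on a fibre of $x \mapsto f(x+a)-f(x)$ the map $x \mapsto x \bmod p$ is injective if
  $p \nmid a$, and $x \bmod p$ is constant if $p \mid a$.  So every fibre has at
  most $p$ elements; since $p$ fibres cover $p^2$ points, each has exactly $p$.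

  If $m = de$ with $d, e > 1$, then $f(x+m) = f(x) = 0$ for the $me > m$ multiples $x$ of $d$
  modulo $m^2$, so the fibre of $0$ for the shift $m$ is too large.
\<close>

section \<open>Perfect nonlinearity as a count of integers in an interval\<close>

lemma carrier_integer_mod_group_pos:
  assumes "n > 0"
  shows "carrier (integer_mod_group n) = {0..<int n}"
  using assms by (simp add: carrier_integer_mod_group)

lemma perfect_nonlinear_carmichael_fun_iff:
  assumes "m \<ge> 2"
  shows "perfect_nonlinear (integer_mod_group (m\<^sup>2)) (integer_mod_group m) (carmichael_fun m)
    \<longleftrightarrow> (\<forall>a \<in> {0<..<(int m)\<^sup>2}. \<forall>b \<in> {0..<int m}.
          card {x \<in> {0..<(int m)\<^sup>2}. (carmichael_fun m (x + a) - carmichael_fun m x) mod int m = b} = m)"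
proof -
  have m: "m > 0" "m\<^sup>2 > 0"
    using assms by auto
  have dom: "carrier (integer_mod_group (m\<^sup>2)) - {\<one>\<^bsub>integer_mod_group (m\<^sup>2)\<^esub>} = {0<..<(int m)\<^sup>2}"
    using m by (auto simp: carrier_integer_mod_group_pos)
  have shift: "carmichael_fun m ((x + a) mod (int m)\<^sup>2) = carmichael_fun m (x + a)" for x a
    using assms by (intro carmichael_fun_cong) (simp_all add: cong_def)
  have mem: "carmichael_fun m x \<in> carrier (integer_mod_group m)" for x
    using m by (simp add: carrier_integer_mod_group_pos carmichael_fun_def)
  have diff: "carmichael_fun m (x \<otimes>\<^bsub>integer_mod_group (m\<^sup>2)\<^esub> a)
        \<otimes>\<^bsub>integer_mod_group m\<^esub> inv\<^bsub>integer_mod_group m\<^esub> carmichael_fun m x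
      = (carmichael_fun m (x + a) - carmichael_fun m x) mod int m" for x a
    using mem[of x] by (simp add: mult_integer_mod_group inv_integer_mod_group shift mod_simps)
  have quot: "order (integer_mod_group (m\<^sup>2)) div order (integer_mod_group m) = m"
    using m by (simp add: order_def carrier_integer_mod_group_pos nat_power_eq power2_eq_square nat_mult_distrib)
  show ?thesis
    unfolding perfect_nonlinear_def dom diff quot
    using carmichael_fun_setting[OF assms] m
    by (simp add: carrier_integer_mod_group_pos)
qed

section \<open>Values of the function at non-units and under shifts by multiples of a prime\<close>

lemma carmichael_fun_eq_0: "d dvd x \<Longrightarrow> d dvd int m \<Longrightarrow> \<not> is_unit d \<Longrightarrow> carmichael_fun m x = 0"
  by (metis carmichael_fun_def gcd_greatest)

lemma carmichael_fun_shift: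
  assumes p: "prime p" and x: "\<not> int p dvd x"
  shows "[x * (carmichael_fun p (x + int p * k) - carmichael_fun p x) = - k] (mod int p)"
proof -
  define y where "y = x + int p * k"
  have p2: "p \<ge> 2" using p prime_ge_2_nat by blast
  have y: "\<not> int p dvd y" using x by (simp add: y_def dvd_add_left_iff)
  have fermat: "int p * (z * carmichael_quotient p z) = z ^ p - z" if "\<not> int p dvd z" for z
  proof -
    have "coprime z (int p)"
      using that p by (metis prime_imp_coprime coprime_commute prime_nat_int_transfer)
    then have "int p * carmichael_quotient p z = z ^ (p - 1) - 1"
      using carmichael_quotient_exact[OF p2] p by (simp add: Carmichael_prime)
    moreover have "z ^ p = z * z ^ (p - 1)"
      using p2 by (metis power_eq_if not_numeral_le_zero)
    ultimately show ?thesis by (simp add: mult.left_commute[of "int p"] right_diff_distrib)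
  qed
  have fq: "[carmichael_fun p z = carmichael_quotient p z] (mod int p)" if "\<not> int p dvd z" for z
  proof -
    have "coprime z (int p)"
      using that p by (metis prime_imp_coprime coprime_commute prime_nat_int_transfer)
    then show ?thesis by (simp add: carmichael_fun_def coprime_iff_gcd_eq_1)
  qed
  \<comment> \<open>In the factorisation of \<open>y ^ p - x ^ p\<close> both factors are divisible
    by \<open>p\<close>: \<open>y - x\<close> by construction, and the cofactor because it consists
    of \<open>p\<close> terms, each congruent to \<open>x ^ (p - 1)\<close>.\<close>
  have "[y ^ p = x ^ p] (mod int p * int p)"
  proof -
    have "[(\<Sum>i<p. x ^ (p - Suc i) * y ^ i) = (\<Sum>i<p. x ^ (p - Suc i) * x ^ i)] (mod int p)"
      by (intro cong_sum cong_mult cong_pow) (simp_all add: y_def cong_def)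
    also have "(\<Sum>i<p. x ^ (p - Suc i) * x ^ i) = int p * x ^ (p - 1)"
      by (simp flip: power_add)
    finally have "int p dvd (\<Sum>i<p. x ^ (p - Suc i) * y ^ i)"
      by (metis cong_dvd_iff dvd_triv_left)
    moreover have "y ^ p - x ^ p = (y - x) * (\<Sum>i<p. x ^ (p - Suc i) * y ^ i)"
      by (rule power_diff_sumr2)
    moreover have "int p dvd y - x" by (simp add: y_def)
    ultimately show ?thesis by (simp add: cong_iff_dvd_diff mult_dvd_mono)
  qed
  \<comment> \<open>Subtracting the two instances of \<open>fermat\<close> leaves
    \<open>y ^ p - x ^ p\<close> minus \<open>y - x = int p * k\<close>, whence the summand
    \<open>k\<close>; then one factor \<open>p\<close> cancels.\<close>
  then have "int p * int p dvd int p * (y * carmichael_quotient p y - x * carmichael_quotient p x + k)"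
    using fermat[OF x] fermat[OF y] by (simp add: cong_iff_dvd_diff ring_distribs y_def)
  then have "int p dvd y * carmichael_quotient p y - x * carmichael_quotient p x + k"
    using p2 by simp
  then have "[y * carmichael_quotient p y - x * carmichael_quotient p x = - k] (mod int p)"
    by (simp add: cong_iff_dvd_diff)
  moreover have "[x * (carmichael_fun p y - carmichael_fun p x)
      = y * carmichael_quotient p y - x * carmichael_quotient p x] (mod int p)"
    unfolding right_diff_distrib
    by (intro cong_diff cong_mult fq x y) (simp_all add: y_def cong_def)
  ultimately show ?thesis unfolding y_def using cong_trans by blast
qed

section \<open>Fibres of the derivative for a prime modulus\<close>

lemma card_fibre_eq:
  assumes A: "finite A" "card A = n * n" and B: "finite B" "card B = n"
    and g: "g \<in> A \<rightarrow> B" and le: "\<And>b. b \<in> B \<Longrightarrow> card {x \<in> A. g x = b} \<le> n" and b: "b \<in> B"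
  shows "card {x \<in> A. g x = b} = n"
proof (rule ccontr)
  assume "card {x \<in> A. g x = b} \<noteq> n"
  then have "card {x \<in> A. g x = b} < n" using le[OF b] by simp
  \<comment> \<open>One deficient fibre would push the total below \<open>n * n\<close>, yet the
    fibres partition \<open>A\<close>.\<close>
  then have "(\<Sum>b\<in>B. card {x \<in> A. g x = b}) < (\<Sum>b\<in>B. n)"
    using B le b by (intro sum_strict_mono_ex1) auto
  moreover have "(\<Sum>b\<in>B. card {x \<in> A. g x = b}) = card A"
    using sum.group[OF A(1) B(1), of g "\<lambda>_. 1::nat"] g by auto
  ultimately show False using A B by simp
qed

text \<open>In each case \<open>S\<close> is injected into \<open>{0..<int p}\<close>: by the
  residue modulo \<open>p\<close> if \<open>p\<close> does not divide \<open>a\<close>, by the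
  quotient if it does.\<close>

lemma prime_imp_derivative_fibre_le:
  fixes p :: nat and a b :: int
  assumes p: "prime p" and a: "a \<in> {0<..<(int p)\<^sup>2}"
  defines "S \<equiv> {x \<in> {0..<(int p)\<^sup>2}. (carmichael_fun p (x + a) - carmichael_fun p x) mod int p = b}"
  shows "card S \<le> p"
proof -
  let ?f = "carmichael_fun p"
  have p0: "int p > 1" and pp: "prime (int p)"
    using p prime_gt_1_nat by auto
  have zero: "?f x = 0" if "int p dvd x" for x
    using that p0 by (intro carmichael_fun_eq_0[of "int p"]) auto
  have eq: "x = y" if "x \<in> S" "y \<in> S" "x mod int p = y mod int p" "x div int p = y div int p" for x y
    using that by (metis div_mult_mod_eq)
  show ?thesis
  proof (cases "int p dvd a")
    case False
    have "inj_on (\<lambda>x. x mod int p) S"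
    proof (rule inj_onI)
      fix x y assume S: "x \<in> S" "y \<in> S" and xy: "x mod int p = y mod int p"
      then have "int p dvd y - x" by (metis mod_eq_dvd_iff)
      then obtain k where "y - x = int p * k" by blast
      then have k: "y = x + int p * k" by simp
      \<comment> \<open>As \<open>x\<close> and \<open>y\<close> lie in one fibre, the increment
        \<open>e\<close> from \<open>x\<close> to \<open>y\<close> agrees modulo \<open>p\<close>
        with that from \<open>x + a\<close> to \<open>y + a\<close>. The shift congruence can thus
        be applied to \<open>e\<close> at two base points with the same \<open>k\<close>.\<close>
      define e where "e = ?f y - ?f x"
      have e: "[?f (y + a) - ?f (x + a) = e] (mod int p)"
      proof -
        have "[?f (y + a) - ?f y = ?f (x + a) - ?f x] (mod int p)"
          using S by (simp add: S_def cong_def)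
        then show ?thesis by (simp add: e_def cong_iff_dvd_diff algebra_simps)
      qed
      have e1: "[x * e = - k] (mod int p)" if "\<not> int p dvd x"
        using carmichael_fun_shift[OF p that, of k] by (simp add: e_def k)
      have e2: "[(x + a) * e = - k] (mod int p)" if "\<not> int p dvd x + a"
      proof -
        have "[(x + a) * e = (x + a) * (?f (y + a) - ?f (x + a))] (mod int p)"
          by (rule cong_scalar_left[OF cong_sym[OF e]])
        also have "[(x + a) * (?f (y + a) - ?f (x + a)) = - k] (mod int p)"
          using carmichael_fun_shift[OF p that, of k] by (simp add: k add_ac)
        finally show ?thesis .
      qed
      \<comment> \<open>If \<open>p\<close> divides a base point, the function vanishes at both ends
        of that increment; otherwise subtracting \<open>e1\<close> from \<open>e2\<close> gives
        \<open>p\<close> dividing \<open>a * e\<close>.\<close>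
      have "int p dvd e"
      proof (cases "int p dvd x \<or> int p dvd x + a")
        case True
        then show ?thesis
        proof
          assume "int p dvd x"
          then show ?thesis by (simp add: e_def k zero)
        next
          assume "int p dvd x + a"
          moreover from this have "int p dvd y + a"
            using dvd_add[OF _ dvd_triv_left, of "int p" "x + a" k] by (simp add: k add_ac)
          ultimately show ?thesis using e by (simp add: zero cong_iff_dvd_diff)
        qed
      next
        case False
        then have "[(x + a) * e - x * e = - k - (- k)] (mod int p)"
          by (intro cong_diff e1 e2) auto
        then have "int p dvd a * e" by (simp add: cong_iff_dvd_diff algebra_simps)
        then show ?thesis using pp \<open>\<not> int p dvd a\<close> prime_dvd_mult_iff by blast
      qed
      \<comment> \<open>At least one of \<open>e1\<close> and \<open>e2\<close> is therefore
        available, and it turns \<open>p\<close> dividing \<open>e\<close> into \<open>p\<close>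
        dividing \<open>k\<close>.\<close>
      moreover have "\<not> int p dvd x \<or> \<not> int p dvd x + a"
        using \<open>\<not> int p dvd a\<close> by (metis dvd_add_right_iff)
      ultimately have "int p dvd k"
        using e1 e2 by (metis cong_dvd_iff dvd_minus_iff dvd_mult)
      then have "[x = y] (mod (int p)\<^sup>2)"
        by (simp add: k cong_iff_dvd_diff power2_eq_square)
      then show "x = y" using S by (simp add: S_def cong_def)
    qed
    moreover have "(\<lambda>x. x mod int p) ` S \<subseteq> {0..<int p}" using p0 by auto
    ultimately have "card S \<le> card {0..<int p}" by (intro card_inj_on_le) auto
    then show ?thesis by simp
  next
    case True
    then obtain c where c: "a = int p * c" by blast
    \<comment> \<open>Otherwise \<open>p * p\<close> would divide \<open>a\<close>, which lies
      strictly between 0 and \<open>p * p\<close>.\<close>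
    have nc: "\<not> int p dvd c"
      using a zdvd_imp_le[of "(int p)\<^sup>2" a] by (auto simp: c power2_eq_square)
    have xb: "[x * b = - c] (mod int p)" if "x \<in> S" "\<not> int p dvd x" for x
    proof -
      have "[b = ?f (x + a) - ?f x] (mod int p)"
        using that by (auto simp: S_def cong_def)
      then have "[x * b = x * (?f (x + a) - ?f x)] (mod int p)"
        by (rule cong_scalar_left)
      also have "[x * (?f (x + a) - ?f x) = - c] (mod int p)"
        using carmichael_fun_shift[OF p that(2), of c] by (simp add: c)
      finally show ?thesis .
    qed
    \<comment> \<open>Together with \<open>nb\<close> this is a dichotomy: if \<open>p\<close>
      divides \<open>b\<close>, all points of \<open>S\<close> are multiples of \<open>p\<close>; if
      not, none is, and \<open>xb\<close> determines \<open>x\<close> modulo \<open>p\<close> by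
      cancelling \<open>b\<close>. Either way the residue is constant on \<open>S\<close>, so the
      quotient separates points.\<close>
    have b0: "int p dvd b" if "x \<in> S" "int p dvd x" for x
      using that by (auto simp: S_def zero c)
    have nb: "\<not> int p dvd b" if "x \<in> S" "\<not> int p dvd x" for x
      using xb[OF that] nc by (metis cong_dvd_iff dvd_minus_iff dvd_mult)
    have "inj_on (\<lambda>x. x div int p) S"
    proof (rule inj_onI)
      fix x y assume S: "x \<in> S" "y \<in> S" and xy: "x div int p = y div int p"
      have "[x = y] (mod int p)"
      proof (cases "int p dvd b")
        case True
        then have "int p dvd x" "int p dvd y" using nb S by blast+
        then show ?thesis by (simp add: cong_def)
      next
        case False
        then have "[x * b = y * b] (mod int p)"
          using xb b0 S by (meson cong_sym cong_trans)
        then have "int p dvd (x - y) * b" by (simp add: cong_iff_dvd_diff left_diff_distrib)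
        then show ?thesis using pp False prime_dvd_mult_iff cong_iff_dvd_diff by blast
      qed
      then show "x = y" using eq[OF S _ xy] by (simp add: cong_def)
    qed
    moreover have "(\<lambda>x. x div int p) ` S \<subseteq> {0..<int p}"
    proof (rule image_subsetI)
      fix x assume "x \<in> S"
      then have x: "0 \<le> x" "x < int p * int p" by (simp_all add: S_def power2_eq_square)
      have "x div int p * int p \<le> x"
        using div_mult_mod_eq[of x "int p"] pos_mod_sign[of "int p" x] p0 by linarith
      then have "x div int p * int p < int p * int p" using x by linarith
      then show "x div int p \<in> {0..<int p}"
        using x p0 by (auto simp: pos_imp_zdiv_nonneg_iff mult_less_cancel_right)
    qed
    ultimately have "card S \<le> card {0..<int p}" by (intro card_inj_on_le) auto
    then show ?thesis by simp
  qed
qed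

section \<open>Too many zeros of the derivative for a composite modulus\<close>

lemma card_derivative_zeros_ge:
  assumes m: "m = d * e" and d: "d > 1" "e > 0"
  shows "card {x \<in> {0..<(int m)\<^sup>2}. (carmichael_fun m (x + int m) - carmichael_fun m x) mod int m = 0}
    \<ge> m * e"
proof -
  let ?S = "{x \<in> {0..<(int m)\<^sup>2}. (carmichael_fun m (x + int m) - carmichael_fun m x) mod int m = 0}"
  have zero: "carmichael_fun m x = 0" if "int d dvd x" for x
    using that d by (intro carmichael_fun_eq_0[of "int d"]) (auto simp: m)
  \<comment> \<open>The bound on \<open>i\<close> comes from \<open>m * m = d * (m * e)\<close>.
    Since \<open>d\<close> divides \<open>m\<close>, both \<open>d * i\<close> and its shift by
    \<open>m\<close> share the factor \<open>d\<close> with \<open>m\<close>.\<close>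
  have "(\<lambda>i. int d * i) ` {0..<int (m * e)} \<subseteq> ?S"
  proof safe
    fix i assume i: "i \<in> {0..<int (m * e)}"
    have "int d * i < int d * int (m * e)" using i d by simp
    then show "int d * i \<in> {0..<(int m)\<^sup>2}"
      using i by (simp add: m power2_eq_square mult_ac)
    show "(carmichael_fun m (int d * i + int m) - carmichael_fun m (int d * i)) mod int m = 0"
      using zero[of "int d * i + int m"] zero[of "int d * i"] by (simp add: m)
  qed
  moreover have "finite ?S" by (rule finite_subset[of _ "{0..<(int m)\<^sup>2}"]) auto
  moreover have "inj_on (\<lambda>i. int d * i) {0..<int (m * e)}"
    using d by (auto simp: inj_on_def)
  ultimately have "card {0..<int (m * e)} \<le> card ?S"
    by (intro card_inj_on_le[of "\<lambda>i. int d * i"]) auto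
  then show ?thesis by (simp only: card_atLeastLessThan_int diff_zero nat_int)
qed

theorem proposition5p2:
  fixes m :: nat
  assumes "m \<ge> 2"
  shows "perfect_nonlinear (integer_mod_group (m\<^sup>2)) (integer_mod_group m) (carmichael_fun m)
    \<longleftrightarrow> prime m"
  unfolding perfect_nonlinear_carmichael_fun_iff[OF assms]
proof (intro iffI ballI)
  fix a b assume m: "prime m" and a: "a \<in> {0<..<(int m)\<^sup>2}" and b: "b \<in> {0..<int m}"
  show "card {x \<in> {0..<(int m)\<^sup>2}. (carmichael_fun m (x + a) - carmichael_fun m x) mod int m = b} = m"
  proof (rule card_fibre_eq[where B = "{0..<int m}"])
    show "card {0..<(int m)\<^sup>2} = m * m"
      by (simp add: power2_eq_square nat_mult_distrib)
  qed (use assms b prime_imp_derivative_fibre_le[OF m a] in auto)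
next
  assume *: "\<forall>a\<in>{0<..<(int m)\<^sup>2}. \<forall>b\<in>{0..<int m}.
    card {x \<in> {0..<(int m)\<^sup>2}. (carmichael_fun m (x + a) - carmichael_fun m x) mod int m = b} = m"
  \<comment> \<open>The shift \<open>m\<close> is a nonidentity element; with \<open>b = 0\<close>
    its fibre would have exactly \<open>m\<close> elements, against at least \<open>m * e\<close>
    with \<open>e > 1\<close>.\<close>
  have mm: "int m \<in> {0<..<(int m)\<^sup>2}" using assms by (simp add: power2_eq_square)
  show "prime m"
  proof (rule ccontr)
    assume "\<not> prime m"
    then obtain d where d: "d dvd m" "d \<noteq> 1" "d \<noteq> m"
      using assms by (auto simp: prime_nat_iff)
    then obtain e where "m = d * e" by blast
    moreover from this have "d > 1" "e > 1"
      using assms d by (auto intro!: Suc_lessI Nat.gr0I)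
    ultimately have de: "m = d * e" "d > 1" "e > 1" by blast+
    have "m * e \<le> m"
      using card_derivative_zeros_ge[OF de(1,2)] * mm assms de by force
    then show False using de assms by simp
  qed
qed

end
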